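(* Let $(\mathcal{M},\boldsymbol{g})$ be a four-dimensional oriented space-time of signature $(+,-,-,-)$, let $p\in\mathcal{M}$, and let $\boldsymbol{F}\in\Lambda^2(T_p^*\mathcal{M})$ be a regular 2-form with disformal metric $\tilde{\boldsymbol{g}}=-\kappa_g^{-1}\left(\boldsymbol{F}^{2_g}+\frac{\psi_g}{2}\boldsymbol{g}\right)$. Then the energy-momentum tensor constructed with $\boldsymbol{F}$ and $\tilde{\boldsymbol{g}}$, $$\tilde{\boldsymbol{T}}=\boldsymbol{F}^{2_{\tilde g}}+\frac{\psi_{\tilde g}}{2}\tilde{\boldsymbol{g}},$$ satisfies $$\tilde{\boldsymbol{T}}=-\kappa_g\,\boldsymbol{g}.$$
   Context: Conventions. For a Lorentzian metric $\boldsymbol{h}$ of signature $(+,-,-,-)$ on the oriented 4-manifold $\mathcal{M}$, with $h=\det(h_{ab})$ in positively oriented coordinates and $[abcd]$ the Levi-Civita permutation symbol with $[0123]=1$, the Hodge dual of a 2-form $\boldsymbol{G}$ is $\star_{h}G_{ab}=\frac12\sqrt{-h}\,[abcd](h^{-1})^{cp}(h^{-1})^{dq}G_{pq}$ (the same orientation is used for all metrics), and the inner product of 2-forms is $\langle\boldsymbol{G},\boldsymbol{H}\rangle_h=\frac12(h^{-1})^{ac}(h^{-1})^{bd}G_{ab}H_{cd}$. Products are $[(\boldsymbol{A}\boldsymbol{B})_h]_{ab}=(h^{-1})^{cd}A_{ac}B_{db}$, so $(\boldsymbol{F}^{2_h})_{ab}=F_{ac}(h^{-1})^{cd}F_{db}$.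 Invariants of $\boldsymbol{F}$: $\psi_h=\langle\boldsymbol{F},\boldsymbol{F}\rangle_h$, $\phi_h=\langle\boldsymbol{F},\star_h\boldsymbol{F}\rangle_h$, $\kappa_h=\frac12\sqrt{\psi_h^2+\phi_h^2}$. $\boldsymbol{F}$ is regular (with respect to $\boldsymbol{g}$) if $\kappa_g\neq0$. The disformal transform $\tilde{\boldsymbol{g}}$ of $\boldsymbol{g}$ induced by a regular $\boldsymbol{F}$ is a symmetric non-degenerate tensor of signature $(+,-,-,-)$. *)

theory Defs
  imports "HOL-Analysis.Analysis"
begin

text \<open>
  The type \<open>'v\<close> plays the role of the tangent space at a point of the space-time. Frames of it
  are indexed by the type \<open>4\<close>, whose elements are \<open>0, 1, 2, 3\<close> (the numeral \<open>4\<close> is again \<open>0\<close>).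
  In the definitions below the frame argument \<open>e\<close> is the coordinate frame in which the component
  formulas are evaluated; it is meant to be positively oriented.
\<close>

type_synonym 'v frame = "4 \<Rightarrow> 'v"

type_synonym 'v tensor = "'v \<Rightarrow> 'v \<Rightarrow> real"

definition frame :: "'v::real_vector frame \<Rightarrow> bool" where
  "frame e \<longleftrightarrow> inj e \<and> independent (range e) \<and> span (range e) = UNIV"

definition coord :: "'v::real_vector frame \<Rightarrow> 'v \<Rightarrow> 4 \<Rightarrow> real" where
  "coord e v a = representation (range e) v (e a)"

definition frame_change :: "'v::real_vector frame \<Rightarrow> 'v frame \<Rightarrow> real^4^4" where
  "frame_change e f = (\<chi> a b. coord e (f b) a)"

text \<open>An orientation is given by the set of its positively oriented frames.\<close>

definition orientation :: "'v::real_vector frame set \<Rightarrow> bool" where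
  "orientation Or \<longleftrightarrow> Or \<noteq> {} \<and>
     (\<forall>e\<in>Or. frame e \<and> (\<forall>f. f \<in> Or \<longleftrightarrow> frame f \<and> 0 < det (frame_change e f)))"

definition minkowski :: "4 \<Rightarrow> 4 \<Rightarrow> real" where
  "minkowski a b = (if a = b then (if a = 0 then 1 else -1) else 0)"

definition lorentzian :: "'v::real_vector tensor \<Rightarrow> bool" where
  "lorentzian h \<longleftrightarrow> bilinear h \<and> (\<forall>u v. h u v = h v u) \<and>
     (\<exists>f. frame f \<and> (\<forall>a b. h (f a) (f b) = minkowski a b))"

definition two_form :: "'v::real_vector tensor \<Rightarrow> bool" where
  "two_form G \<longleftrightarrow> bilinear G \<and> (\<forall>u v. G u v = - G v u)"

definition components :: "'v frame \<Rightarrow> 'v tensor \<Rightarrow> real^4^4" where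
  "components e A = (\<chi> a b. A (e a) (e b))"

definition inv_metric :: "'v frame \<Rightarrow> 'v tensor \<Rightarrow> 4 \<Rightarrow> 4 \<Rightarrow> real" where
  "inv_metric e h a b = matrix_inv (components e h) $ a $ b"

definition levi_civita :: "4 \<Rightarrow> 4 \<Rightarrow> 4 \<Rightarrow> 4 \<Rightarrow> real" where
  "levi_civita a b c d =
     (let p = (\<lambda>i::4. if i = 0 then a else if i = 1 then b else if i = 2 then c else d)
      in if inj p then of_int (sign p) else 0)"

definition hodge_components :: "'v frame \<Rightarrow> 'v tensor \<Rightarrow> 'v tensor \<Rightarrow> 4 \<Rightarrow> 4 \<Rightarrow> real" where
  "hodge_components e h G a b =
     1/2 * sqrt (- det (components e h)) *
     (\<Sum>c\<in>UNIV. \<Sum>d\<in>UNIV. \<Sum>p\<in>UNIV. \<Sum>q\<in>UNIV.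
        levi_civita a b c d * inv_metric e h c p * inv_metric e h d q * G (e p) (e q))"

definition hodge :: "'v::real_vector frame \<Rightarrow> 'v tensor \<Rightarrow> 'v tensor \<Rightarrow> 'v tensor" where
  "hodge e h G u v =
     (\<Sum>a\<in>UNIV. \<Sum>b\<in>UNIV. coord e u a * coord e v b * hodge_components e h G a b)"

definition form_inner :: "'v frame \<Rightarrow> 'v tensor \<Rightarrow> 'v tensor \<Rightarrow> 'v tensor \<Rightarrow> real" where
  "form_inner e h G H =
     1/2 * (\<Sum>a\<in>UNIV. \<Sum>b\<in>UNIV. \<Sum>c\<in>UNIV. \<Sum>d\<in>UNIV.
        inv_metric e h a c * inv_metric e h b d * G (e a) (e b) * H (e c) (e d))"

definition tensor_prod :: "'v frame \<Rightarrow> 'v tensor \<Rightarrow> 'v tensor \<Rightarrow> 'v tensor \<Rightarrow> 'v tensor" where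
  "tensor_prod e h A B u v =
     (\<Sum>c\<in>UNIV. \<Sum>d\<in>UNIV. inv_metric e h c d * A u (e c) * B (e d) v)"

definition psi :: "'v frame \<Rightarrow> 'v tensor \<Rightarrow> 'v tensor \<Rightarrow> real" where
  "psi e h F = form_inner e h F F"

definition phi :: "'v::real_vector frame \<Rightarrow> 'v tensor \<Rightarrow> 'v tensor \<Rightarrow> real" where
  "phi e h F = form_inner e h F (hodge e h F)"

definition kappa :: "'v::real_vector frame \<Rightarrow> 'v tensor \<Rightarrow> 'v tensor \<Rightarrow> real" where
  "kappa e h F = 1/2 * sqrt ((psi e h F)\<^sup>2 + (phi e h F)\<^sup>2)"

definition regular :: "'v::real_vector frame \<Rightarrow> 'v tensor \<Rightarrow> 'v tensor \<Rightarrow> bool" where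
  "regular e h F \<longleftrightarrow> kappa e h F \<noteq> 0"

definition disformal_metric :: "'v::real_vector frame \<Rightarrow> 'v tensor \<Rightarrow> 'v tensor \<Rightarrow> 'v tensor" where
  "disformal_metric e g F u v =
     - inverse (kappa e g F) * (tensor_prod e g F F u v + psi e g F / 2 * g u v)"

definition energy_momentum :: "'v frame \<Rightarrow> 'v tensor \<Rightarrow> 'v tensor \<Rightarrow> 'v tensor" where
  "energy_momentum e h F u v = tensor_prod e h F F u v + psi e h F / 2 * h u v"

end

(*
In a frame let A, G be the matrices of F, g, put B = G^-1, M = A B, U = B A B, and write *X for the
matrix of complementary entries of a skew 4x4 matrix X. The identities A *A = -Pf(A) 1 and
A U + *U *A = (tr(A U)/2) 1 give, since M^2 = A U,
  M^4 + psi M^2 + Pf(A) Pf(U) 1 = 0,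
while Pf(A) = det G Pf(U) and phi = -2 sqrt(-det G) Pf(U). Hence Y = M^2 + psi/2 satisfies
Y^2 = kappa^2 1. The disformal metric is -Y G / kappa, with inverse -B Y / kappa, so A times this
inverse is -M Y / kappa, whose square is M^2; thus psi is unchanged, and the new energy-momentum
matrix is -Y (Y G) / kappa = -kappa G.
*)
theory Submission
  imports Defs
begin

section \<open>Pfaffian and dual of a skew 4 x 4 matrix\<close>

text \<open>Rows and columns are ordered 1, 2, 3, 4, whereas the definition of the Levi-Civita symbol
  orders them 0, 1, 2, 3 with 0 = 4. This is an odd permutation, whence the sign in
  \<open>phi_eq_pfaffian\<close>.\<close>

definition pfaffian :: "real^4^4 \<Rightarrow> real" where
  "pfaffian U = U$1$2 * U$3$4 - U$1$3 * U$2$4 + U$1$4 * U$2$3"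

text \<open>For distinct a and b the entry is \<open>U$c$d\<close> with (a, b, c, d) an even
  permutation of (1, 2, 3, 4): the Hodge dual stripped of metric and volume factor.\<close>

definition dual_matrix :: "real^4^4 \<Rightarrow> real^4^4" where
  "dual_matrix U = (\<chi> a b.
     if a = 1 then (if b = 2 then U$3$4 else if b = 3 then U$4$2 else if b = 4 then U$2$3 else 0)
     else if a = 2 then (if b = 1 then U$4$3 else if b = 3 then U$1$4 else if b = 4 then U$3$1 else 0)
     else if a = 3 then (if b = 1 then U$2$4 else if b = 2 then U$4$1 else if b = 4 then U$1$2 else 0)
     else (if b = 1 then U$3$2 else if b = 2 then U$1$3 else if b = 3 then U$2$1 else 0))"

text \<open>As rewrite rules these leave only the six entries above the diagonal, so that matrix
  identities become polynomial identities in them.\<close>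

lemma skew_entries_4:
  assumes "transpose A = - (A :: real^4^4)"
  shows "A$1$1 = 0" "A$2$2 = 0" "A$3$3 = 0" "A$4$4 = 0"
    "A$2$1 = - A$1$2" "A$3$1 = - A$1$3" "A$4$1 = - A$1$4"
    "A$3$2 = - A$2$3" "A$4$2 = - A$2$4" "A$4$3 = - A$3$4"
proof -
  have "A$b$a = - A$a$b" for a b
    using arg_cong[OF assms, of "\<lambda>M. M$a$b"] by (simp add: transpose_def)
  from this[of 1 1] this[of 2 2] this[of 3 3] this[of 4 4]
    this[of 1 2] this[of 1 3] this[of 1 4] this[of 2 3] this[of 2 4] this[of 3 4]
  show "A$1$1 = 0" "A$2$2 = 0" "A$3$3 = 0" "A$4$4 = 0"
    "A$2$1 = - A$1$2" "A$3$1 = - A$1$3" "A$4$1 = - A$1$4"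
    "A$3$2 = - A$2$3" "A$4$2 = - A$2$4" "A$4$3 = - A$3$4"
    by linarith+
qed

text \<open>Each diagonal entry is, up to sign, the expansion of the Pfaffian along one row; off the
  diagonal the two remaining terms cancel.\<close>

lemma skew_mult_dual_matrix:
  assumes "transpose A = - A"
  shows "A ** dual_matrix A = - pfaffian A *\<^sub>R mat 1"
  by (simp add: vec_eq_iff forall_4 matrix_matrix_mult_def sum_4 dual_matrix_def pfaffian_def mat_def
      skew_entries_4[OF assms] algebra_simps)

text \<open>Polarization of \<open>skew_mult_dual_matrix\<close> at the pair \<open>A\<close>,
  \<open>dual_matrix U\<close>: dualizing is an involution on skew matrices, and the polar form of
  the Pfaffian at this pair is \<open>- trace (A ** U) / 2\<close>.\<close>

lemma skew_mult_dual_matrix_polarized: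
  assumes "transpose A = - A" and "transpose U = - U"
  shows "A ** U + dual_matrix U ** dual_matrix A = (trace (A ** U) / 2) *\<^sub>R mat 1"
  by (simp add: vec_eq_iff forall_4 matrix_matrix_mult_def sum_4 dual_matrix_def trace_def mat_def
      skew_entries_4[OF assms(1)] skew_entries_4[OF assms(2)] algebra_simps)

section \<open>Permutation sums, determinant and congruence\<close>

lemma sum_permutations_4:
  fixes t :: "4 \<Rightarrow> 4 \<Rightarrow> 4 \<Rightarrow> 4 \<Rightarrow> real"
  shows "(\<Sum>p | p permutes (UNIV :: 4 set). of_int (sign p) * t (p 1) (p 2) (p 3) (p 4)) =
     t 1 2 3 4 - t 1 2 4 3 - t 1 3 2 4 + t 1 3 4 2 + t 1 4 2 3 - t 1 4 3 2
   - t 2 1 3 4 + t 2 1 4 3 + t 2 3 1 4 - t 2 3 4 1 - t 2 4 1 3 + t 2 4 3 1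
   + t 3 1 2 4 - t 3 1 4 2 - t 3 2 1 4 + t 3 2 4 1 + t 3 4 1 2 - t 3 4 2 1
   - t 4 1 2 3 + t 4 1 3 2 + t 4 2 1 3 - t 4 2 3 1 - t 4 3 1 2 + t 4 3 2 1"
proof -
  \<comment> \<open>The indices 1, 2, 3 are split off in turn: a permutation of
    \<open>insert a S\<close> is a swap of \<open>a\<close> with some element, composed with a
    permutation of \<open>S\<close>.\<close>
  have f1: "finite {2::4, 3, 4}" "1 \<notin> {2::4, 3, 4}" by auto
  have f2: "finite {3::4, 4}" "2 \<notin> {3::4, 4}" by auto
  have f3: "finite {4::4}" "3 \<notin> {4::4}" by auto
  show ?thesis
    unfolding UNIV_4
    unfolding sum_over_permutations_insert[OF f1]
    unfolding sum_over_permutations_insert[OF f2]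
    unfolding sum_over_permutations_insert[OF f3]
    unfolding permutes_sing
    by (simp add: sign_swap_id permutation_swap_id permutation_compose sign_compose sign_id
        split del: if_split)
qed

lemma det_4:
  fixes A :: "real^4^4"
  shows "det A = (\<Sum>p | p permutes UNIV. of_int (sign p) * (A$1$(p 1) * A$2$(p 2) * A$3$(p 3) * A$4$(p 4)))"
proof -
  have "prod f (UNIV :: 4 set) = f 1 * f 2 * f 3 * f 4" for f :: "4 \<Rightarrow> real"
    unfolding UNIV_4 by (simp add: mult_ac)
  then show ?thesis
    unfolding det_def by simp
qed

text \<open>Half the exterior square of a 2-form is its Pfaffian times the volume element, hence the
  determinant. The proof verifies this by expansion, with the entries written through 2 x 2 minors
  of \<open>B\<close>.\<close>

lemma pfaffian_congruence:
  assumes "transpose A = - A"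
  shows "pfaffian (B ** A ** transpose B) = det B * pfaffian A"
proof -
  have entry: "(B ** A ** transpose B)$i$j =
      A$1$2 * (B$i$1 * B$j$2 - B$i$2 * B$j$1) + A$1$3 * (B$i$1 * B$j$3 - B$i$3 * B$j$1)
    + A$1$4 * (B$i$1 * B$j$4 - B$i$4 * B$j$1) + A$2$3 * (B$i$2 * B$j$3 - B$i$3 * B$j$2)
    + A$2$4 * (B$i$2 * B$j$4 - B$i$4 * B$j$2) + A$3$4 * (B$i$3 * B$j$4 - B$i$4 * B$j$3)" for i j
    by (simp add: matrix_matrix_mult_def sum_4 Finite_Cartesian_Product.transpose_def
      skew_entries_4[OF assms] algebra_simps)
  show ?thesis
    unfolding det_4 pfaffian_def entry
      sum_permutations_4[of "\<lambda>a b c d. B$1$a * B$2$b * B$3$c * B$4$d"]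
    by (simp only: algebra_simps)
qed

section \<open>Matrix algebra and the disformal metric as a matrix\<close>

lemma matrix_mult_minus_left: "(- A) ** B = - (A ** B)"
  for A :: "'a::ring_1^'n^'m"
  by (simp add: vec_eq_iff matrix_matrix_mult_def sum_negf)

lemma matrix_mult_minus_right: "A ** (- B) = - (A ** B)"
  for A :: "'a::ring_1^'n^'m"
  by (simp add: vec_eq_iff matrix_matrix_mult_def sum_negf)

lemma matrix_add_rdistrib: "(A + B) ** C = A ** C + B ** C"
  for A :: "'a::semiring_1^'n^'m"
  by (simp add: vec_eq_iff matrix_matrix_mult_def sum.distrib distrib_right)

lemma transpose_add: "transpose (A + B) = transpose A + transpose B"
  by (simp add: vec_eq_iff transpose_def)

lemma transpose_minus: "transpose (- A) = - transpose A"
  by (simp add: vec_eq_iff transpose_def)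

text \<open>Rewriting towards sums of scalar multiples of left-associated products.\<close>

lemmas matrix_algebra = matrix_add_ldistrib matrix_add_rdistrib matrix_mult_minus_left
  matrix_mult_minus_right scalar_matrix_assoc[symmetric] matrix_scalar_ac matrix_mul_assoc

text \<open>This is the Cayley-Hamilton equation of \<open>M\<close>: its coefficients of odd degree
  vanish, and its constant term is \<open>det M = pfaffian A * pfaffian U\<close>.\<close>

lemma skew_sandwich_quartic:
  fixes A B G :: "real^4^4"
  assumes A: "transpose A = - A" and B: "transpose B = B" and GB: "G ** B = mat 1"
  defines "M \<equiv> A ** B" and "U \<equiv> B ** A ** B"
  shows "M ** M ** (M ** M) =
    (trace (M ** M) / 2) *\<^sub>R (M ** M) - (det G * (pfaffian U)\<^sup>2) *\<^sub>R mat 1"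
proof -
  have BG: "B ** G = mat 1"
    using GB matrix_left_right_inverse by blast
  then have tG: "transpose G = G"
    by (metis B GB matrix_mul_assoc matrix_mul_lid matrix_mul_rid matrix_transpose_mul transpose_mat)
  have tU: "transpose U = - U"
    by (simp add: U_def matrix_transpose_mul A B matrix_algebra)
  \<comment> \<open>Lowering both indices of \<open>U\<close> recovers \<open>A\<close>; symmetry of
    \<open>G\<close> turns this into a congruence.\<close>
  have "A = G ** U ** transpose G"
    by (metis BG U_def GB matrix_mul_assoc matrix_mul_lid matrix_mul_rid tG)
  then have pfA: "pfaffian A = det G * pfaffian U"
    using pfaffian_congruence[OF tU] by metis
  have MM: "M ** M = A ** U"
    by (simp add: M_def U_def matrix_mul_assoc)
  have AU: "A ** U = (trace (A ** U) / 2) *\<^sub>R mat 1 + - (dual_matrix U ** dual_matrix A)"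
    using skew_mult_dual_matrix_polarized[OF A tU] by (simp add: algebra_simps)
  \<comment> \<open>Only the second factor is replaced. This puts \<open>U\<close> next to
    \<open>dual_matrix U\<close>, and once that product is a scalar, \<open>A\<close> next to
    \<open>dual_matrix A\<close>.\<close>
  have "A ** U ** (A ** U) = (trace (A ** U) / 2) *\<^sub>R (A ** U) + - (A ** (U ** dual_matrix U) ** dual_matrix A)"
    by (subst (2) AU) (simp add: matrix_algebra del: add_uminus_conv_diff)
  also have "A ** (U ** dual_matrix U) ** dual_matrix A = - pfaffian U *\<^sub>R (A ** dual_matrix A)"
    unfolding skew_mult_dual_matrix[OF tU] by (simp add: matrix_algebra)
  also have "\<dots> = (det G * (pfaffian U)\<^sup>2) *\<^sub>R mat 1"
    unfolding skew_mult_dual_matrix[OF A] pfA by (simp add: power2_eq_square)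
  finally show ?thesis
    unfolding MM by simp
qed

text \<open>The theorem for matrices, with \<open>s\<close> for psi, \<open>k\<close> for kappa and
  \<open>G'\<close> for the disformal metric. The first two conclusions identify psi of the new
  metric with \<open>s\<close>; the third then concerns its energy-momentum tensor.\<close>

lemma disformal_matrix:
  fixes A B G :: "real^4^4"
  assumes A: "transpose A = - A" and B: "transpose B = B" and GB: "G ** B = mat 1"
    and s: "s = - trace (A ** B ** A ** B) / 2"
    and k: "k\<^sup>2 = s\<^sup>2 / 4 - det G * (pfaffian (B ** A ** B))\<^sup>2" "k \<noteq> 0"
    and G': "G' = - inverse k *\<^sub>R (A ** B ** A + (s / 2) *\<^sub>R G)"
  defines "B' \<equiv> matrix_inv G'"
  shows "transpose B' = B'" and "trace (A ** B' ** A ** B') = trace (A ** B ** A ** B)"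
    and "A ** B' ** A + (s / 2) *\<^sub>R G' = - k *\<^sub>R G"
proof -
  define M where "M = A ** B"
  define Y where "Y = M ** M + (s / 2) *\<^sub>R mat 1"
  have kk: "inverse k * inverse k * k\<^sup>2 = 1" "inverse k * k\<^sup>2 = k"
    using k(2) by (simp_all add: power2_eq_square field_simps)
  have BG: "B ** G = mat 1"
    using GB matrix_left_right_inverse by blast
  have s': "trace (M ** M) / 2 = - s"
    by (simp add: s M_def matrix_mul_assoc)
  have "Y ** Y = M ** M ** (M ** M) + s *\<^sub>R (M ** M) + (s\<^sup>2 / 4) *\<^sub>R mat 1"
    by (simp add: Y_def matrix_algebra) (simp add: vec_eq_iff power2_eq_square algebra_simps)
  also have "M ** M ** (M ** M) =
      - s *\<^sub>R (M ** M) - (det G * (pfaffian (B ** A ** B))\<^sup>2) *\<^sub>R mat 1"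
    using skew_sandwich_quartic[OF A B GB] unfolding M_def[symmetric] s' .
  finally have YY: "Y ** Y = k\<^sup>2 *\<^sub>R mat 1"
    by (simp add: k algebra_simps)
  \<comment> \<open>Commuting lets the two factors \<open>Y\<close> in the square of
    \<open>A ** B'\<close> meet and give \<open>k\<^sup>2\<close>.\<close>
  have MY: "M ** Y = Y ** M"
    by (simp add: Y_def matrix_algebra)
  have G'Y: "G' = - inverse k *\<^sub>R (Y ** G)"
  proof -
    have "Y ** G = A ** B ** A ** (B ** G) + (s / 2) *\<^sub>R G"
      by (simp add: Y_def M_def matrix_algebra)
    then show ?thesis by (simp add: G' BG)
  qed
  \<comment> \<open>The inverse of \<open>Y\<close> is \<open>Y\<close> divided by
    \<open>k\<^sup>2\<close>, so inverting \<open>- inverse k *\<^sub>R (Y ** G)\<close> gives this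
    matrix.\<close>
  define C where "C = - inverse k *\<^sub>R (B ** Y)"
  have "G' ** C = (inverse k * inverse k) *\<^sub>R (Y ** (G ** B) ** Y)"
    by (simp add: G'Y C_def matrix_algebra)
  also have "\<dots> = mat 1"
    by (simp add: GB YY kk)
  finally have G'C: "G' ** C = mat 1" .
  then have CG': "C ** G' = mat 1"
    using matrix_left_right_inverse by blast
  \<comment> \<open>\<open>matrix_inv\<close> is a choice among two-sided inverses; \<open>C\<close>
    shows that one exists, and inverses are unique.\<close>
  have B'C: "B' = C"
  proof -
    have "\<exists>X. G' ** X = mat 1 \<and> X ** G' = mat 1"
      using G'C CG' by blast
    then have "B' ** G' = mat 1"
      unfolding B'_def matrix_inv_def by (rule someI2_ex) blast
    then show ?thesis
      by (metis G'C matrix_mul_assoc matrix_mul_lid matrix_mul_rid)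
  qed
  show "transpose B' = B'"
    by (simp add: B'C C_def Y_def M_def transpose_scalar transpose_add transpose_minus
        matrix_transpose_mul A B matrix_algebra)
  have AB': "A ** B' = - inverse k *\<^sub>R (M ** Y)"
    by (simp add: B'C C_def M_def matrix_algebra)
  have "A ** B' ** A ** B' = (A ** B') ** (A ** B')"
    by (simp add: matrix_mul_assoc)
  also have "\<dots> = (inverse k * inverse k) *\<^sub>R (M ** (Y ** M) ** Y)"
    unfolding AB' by (simp add: matrix_algebra)
  also have "\<dots> = (inverse k * inverse k) *\<^sub>R (M ** M ** (Y ** Y))"
    unfolding MY[symmetric] by (simp add: matrix_mul_assoc)
  also have "\<dots> = A ** B ** A ** B"
    unfolding YY by (simp add: matrix_algebra M_def kk)
  finally show "trace (A ** B' ** A ** B') = trace (A ** B ** A ** B)"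
    by simp
  have "A ** B' ** A = - inverse k *\<^sub>R (Y ** M ** A)"
    unfolding AB' MY by (simp add: matrix_algebra)
  \<comment> \<open>The common left factor \<open>Y\<close> leaves the energy-momentum matrix of
    \<open>G\<close>, which is itself \<open>Y ** G\<close>.\<close>
  then have "A ** B' ** A + (s / 2) *\<^sub>R G' = - inverse k *\<^sub>R (Y ** (A ** B ** A + (s / 2) *\<^sub>R G))"
    by (simp add: G'Y M_def matrix_algebra algebra_simps)
  also have "A ** B ** A + (s / 2) *\<^sub>R G = Y ** G"
    using G'Y k(2) by (simp add: G')
  also have "- inverse k *\<^sub>R (Y ** (Y ** G)) = - k *\<^sub>R G"
    unfolding matrix_mul_assoc YY by (simp add: matrix_algebra kk)
  finally show "A ** B' ** A + (s / 2) *\<^sub>R G' = - k *\<^sub>R G" .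
qed

section \<open>Frames, components and bilinear forms\<close>

lemma coord_frame:
  assumes "frame e"
  shows "coord e (e a) b = (if a = b then 1 else 0)"
  using assms unfolding frame_def coord_def
  by (auto simp: representation_basis inj_eq)

lemma frame_expansion:
  assumes "frame e"
  shows "(\<Sum>a\<in>UNIV. coord e v a *\<^sub>R e a) = v"
proof -
  have "(\<Sum>b\<in>range e. representation (range e) v b *\<^sub>R b) = v"
    using assms by (intro real_vector.sum_representation_eq) (auto simp: frame_def)
  then show ?thesis
    using assms by (simp add: sum.reindex frame_def coord_def o_def)
qed

lemma components_frame_change:
  assumes "bilinear h" and "frame e"
  shows "components f h = transpose (frame_change e f) ** components e h ** frame_change e f"
proof -
  have "h (f a) (f b) = (\<Sum>d\<in>UNIV. (\<Sum>c\<in>UNIV. coord e (f a) c * h (e c) (e d)) * coord e (f b) d)" for a b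
  proof -
    have "h (f a) (f b) =
        h (\<Sum>c\<in>UNIV. coord e (f a) c *\<^sub>R e c) (\<Sum>d\<in>UNIV. coord e (f b) d *\<^sub>R e d)"
      by (simp add: frame_expansion[OF assms(2)])
    also have "\<dots> = (\<Sum>c\<in>UNIV. \<Sum>d\<in>UNIV. coord e (f a) c * h (e c) (e d) * coord e (f b) d)"
      by (simp add: bilinear_sum[OF assms(1)] bilinear_lmul[OF assms(1)] bilinear_rmul[OF assms(1)]
          sum.cartesian_product mult_ac)
    also have "\<dots> = (\<Sum>d\<in>UNIV. (\<Sum>c\<in>UNIV. coord e (f a) c * h (e c) (e d)) * coord e (f b) d)"
      by (subst sum.swap) (simp add: sum_distrib_right)
    finally show ?thesis .
  qed
  then show ?thesis
    by (simp add: vec_eq_iff components_def frame_change_def matrix_matrix_mult_def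
        Finite_Cartesian_Product.transpose_def)
qed

text \<open>Passing to an orthonormal frame multiplies the determinant by a square and yields
  -1.\<close>

lemma lorentzian_det_neg:
  assumes "lorentzian h" and "frame e"
  shows "det (components e h) < 0"
proof -
  obtain f where f: "bilinear h" "\<And>a b. h (f a) (f b) = minkowski a b"
    using assms(1) unfolding lorentzian_def by blast
  have "det (components f h) = (\<Prod>a\<in>UNIV. components f h $ a $ a)"
    by (rule det_diagonal) (simp add: components_def f(2) minkowski_def)
  also have "\<dots> = -1"
    unfolding UNIV_4 by (simp add: components_def f(2) minkowski_def)
  also have "det (components f h) = (det (frame_change e f))\<^sup>2 * det (components e h)"
    unfolding components_frame_change[OF f(1) assms(2), of f]
    by (simp add: det_mul det_transpose power2_eq_square)
  finally have "(det (frame_change e f))\<^sup>2 * det (components e h) < 0"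
    by simp
  then show ?thesis
    by (metis mult_nonneg_nonneg not_less zero_le_power2)
qed

lemma bilinear_frame_ext:
  assumes "frame e" "bilinear h" "bilinear h'" "components e h = components e h'"
  shows "h = h'"
proof (intro ext)
  fix u v
  have eq: "h (e a) (e b) = h' (e a) (e b)" for a b
    using arg_cong[OF assms(4), of "\<lambda>M. M$a$b"] by (simp add: components_def)
  have span: "UNIV \<subseteq> span (range e)"
    using assms(1) by (simp add: frame_def)
  show "h u v = h' u v"
    by (rule bilinear_eq[OF assms(2,3) span span UNIV_I UNIV_I]) (use eq in blast)
qed

lemma components_tensor_prod:
  "components e (tensor_prod e h A B) =
    components e A ** matrix_inv (components e h) ** components e B"
proof -
  have "(\<Sum>c\<in>UNIV. \<Sum>d\<in>UNIV. inv_metric e h c d * A (e a) (e c) * B (e d) (e b)) =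
      (\<Sum>d\<in>UNIV. (\<Sum>c\<in>UNIV. A (e a) (e c) * inv_metric e h c d) * B (e d) (e b))" for a b
    by (subst sum.swap) (simp add: sum_distrib_left sum_distrib_right mult_ac)
  then show ?thesis
    by (simp add: vec_eq_iff components_def tensor_prod_def matrix_matrix_mult_def inv_metric_def)
qed

lemma bilinear_tensor_prod:
  assumes "bilinear A" "bilinear B"
  shows "bilinear (tensor_prod e h A B)"
  unfolding bilinear_def linear_iff tensor_prod_def
  by (simp add: bilinear_ladd[OF assms(1)] bilinear_lmul[OF assms(1)] bilinear_radd[OF assms(2)]
      bilinear_rmul[OF assms(2)] distrib_left distrib_right sum.distrib sum_distrib_left mult_ac)

section \<open>The invariants psi and phi as a trace and a Pfaffian\<close>

lemma sum_quadruple_swap: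
  "(\<Sum>a\<in>A. \<Sum>b\<in>B. \<Sum>c\<in>C. \<Sum>d\<in>D. f a b c d) = (\<Sum>c\<in>C. \<Sum>d\<in>D. \<Sum>b\<in>B. \<Sum>a\<in>A. f a b c d)"
proof -
  have "(\<Sum>a\<in>A. \<Sum>b\<in>B. \<Sum>c\<in>C. \<Sum>d\<in>D. f a b c d) = (\<Sum>b\<in>B. \<Sum>a\<in>A. \<Sum>c\<in>C. \<Sum>d\<in>D. f a b c d)"
    by (rule sum.swap)
  also have "\<dots> = (\<Sum>b\<in>B. \<Sum>c\<in>C. \<Sum>a\<in>A. \<Sum>d\<in>D. f a b c d)"
    by (intro sum.cong refl sum.swap)
  also have "\<dots> = (\<Sum>b\<in>B. \<Sum>c\<in>C. \<Sum>d\<in>D. \<Sum>a\<in>A. f a b c d)"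
    by (intro sum.cong refl sum.swap)
  also have "\<dots> = (\<Sum>c\<in>C. \<Sum>b\<in>B. \<Sum>d\<in>D. \<Sum>a\<in>A. f a b c d)"
    by (rule sum.swap)
  also have "\<dots> = (\<Sum>c\<in>C. \<Sum>d\<in>D. \<Sum>b\<in>B. \<Sum>a\<in>A. f a b c d)"
    by (intro sum.cong refl sum.swap)
  finally show ?thesis .
qed

lemma form_inner_eq:
  fixes e h G
  defines "B \<equiv> matrix_inv (components e h)"
  shows "form_inner e h G H =
    1/2 * (\<Sum>c\<in>UNIV. \<Sum>d\<in>UNIV. (transpose B ** components e G ** B)$c$d * H (e c) (e d))"
proof -
  have "inv_metric e h a b = B$a$b" for a b
    by (simp add: inv_metric_def B_def)
  then show ?thesis
    unfolding form_inner_def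
    \<comment> \<open>With \<open>c\<close>, \<open>d\<close> outermost and \<open>a\<close>
      innermost, the inner sums are the left-associated product that raises both indices of
      \<open>G\<close>.\<close>
    by (subst sum_quadruple_swap)
      (simp add: matrix_matrix_mult_def components_def
        Finite_Cartesian_Product.transpose_def sum_distrib_left sum_distrib_right mult_ac)
qed

lemma psi_eq_trace:
  fixes e h F
  defines "A \<equiv> components e F" and "B \<equiv> matrix_inv (components e h)"
  assumes A: "transpose A = - A" and B: "transpose B = B"
  shows "psi e h F = - trace (A ** B ** A ** B) / 2"
proof -
  \<comment> \<open>Transposing the indices turns the double sum into a trace and produces the
    sign.\<close>
  have F: "F (e c) (e d) = - A$d$c" for c d
    using arg_cong[OF A, of "\<lambda>M. M$d$c"] by (simp add: A_def components_def Finite_Cartesian_Product.transpose_def)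
  have "psi e h F = - 1/2 * trace (B ** A ** B ** A)"
    unfolding psi_def form_inner_eq trace_def B_def[symmetric] A_def[symmetric] F B
      matrix_matrix_mult_def[of "B ** A ** B" A] 
    by (simp add: sum_negf)
  also have "trace (B ** A ** B ** A) = trace (A ** B ** A ** B)"
    using trace_mul_sym[of B "A ** B ** A"] by (simp add: matrix_mul_assoc)
  finally show ?thesis by simp
qed

lemma hodge_frame:
  assumes "frame e"
  shows "hodge e h G (e a) (e b) = hodge_components e h G a b"
proof -
  have "hodge e h G u v =
      (\<Sum>c\<in>UNIV. coord e u c * (\<Sum>d\<in>UNIV. coord e v d * hodge_components e h G c d))" for u v
    by (simp add: hodge_def sum_distrib_left mult_ac)
  then show ?thesis
    by (simp add: coord_frame[OF assms] if_distrib[of "\<lambda>x. x * _"] cong: if_cong)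
qed

lemma hodge_components_eq:
  fixes e h G
  defines "B \<equiv> matrix_inv (components e h)"
  shows "hodge_components e h G a b = 1/2 * sqrt (- det (components e h)) *
    (\<Sum>c\<in>UNIV. \<Sum>d\<in>UNIV. levi_civita a b c d * (B ** components e G ** transpose B)$c$d)"
proof -
  have "(\<Sum>p\<in>UNIV. \<Sum>q\<in>UNIV. levi_civita a b c d * inv_metric e h c p * inv_metric e h d q * G (e p) (e q))
     = levi_civita a b c d * (B ** components e G ** transpose B)$c$d" for c d
    by (subst sum.swap) (simp add: inv_metric_def B_def matrix_matrix_mult_def components_def
      Finite_Cartesian_Product.transpose_def sum_distrib_left sum_distrib_right mult_ac)
  then show ?thesis
    unfolding hodge_components_def by simp
qed

text \<open>Index quadruples correspond to maps of the four indices, and the symbol vanishes unless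
  the map is injective, that is, a permutation.\<close>

lemma sum_levi_civita:
  "(\<Sum>a\<in>UNIV. \<Sum>b\<in>UNIV. \<Sum>c\<in>UNIV. \<Sum>d\<in>UNIV. levi_civita a b c d * t a b c d) =
   (\<Sum>p | p permutes UNIV. of_int (sign p) * t (p 0) (p 1) (p 2) (p 3))"
proof -
  have inj_permutes: "p permutes UNIV" if "inj p" for p :: "4 \<Rightarrow> 4"
    using that by (metis bij_betw_def bij_imp_permutes finite_UNIV_inj_surj finite iso_tuple_UNIV_I)
  let ?tup = "\<lambda>p :: 4 \<Rightarrow> 4. (p 0, p 1, p 2, p 3)"
  \<comment> \<open>The same map is formed inside \<open>levi_civita\<close>; \<open>?tup\<close>
    inverts it.\<close>
  let ?fun = "\<lambda>(a, b, c, d) i :: 4. if i = 0 then a else if i = 1 then b else if i = 2 then c else d :: 4"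
  \<comment> \<open>\<open>exhaust_4\<close> lists the indices as 1, 2, 3, 4, so 0 has to be read as
    4.\<close>
  have zero: "(0 :: 4) = 4"
    by simp
  have fun_tup: "?fun (?tup p) = p" for p
  proof
    show "?fun (?tup p) i = p i" for i
      using exhaust_4[of i] by (auto simp: zero)
  qed
  have "(\<Sum>a\<in>UNIV. \<Sum>b\<in>UNIV. \<Sum>c\<in>UNIV. \<Sum>d\<in>UNIV. levi_civita a b c d * t a b c d) =
      (\<Sum>(a, b, c, d)\<in>UNIV. levi_civita a b c d * t a b c d)"
    by (simp add: sum.cartesian_product UNIV_Times_UNIV)
  also have "\<dots> = (\<Sum>p\<in>UNIV. (if inj p then of_int (sign p) else 0) * t (p 0) (p 1) (p 2) (p 3))"
    by (rule sum.reindex_bij_witness[where i = ?tup and j = ?fun])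
      (use fun_tup in \<open>auto simp: levi_civita_def Let_def\<close>)
  also have "\<dots> = (\<Sum>p | p permutes UNIV. of_int (sign p) * t (p 0) (p 1) (p 2) (p 3))"
    by (rule sum.mono_neutral_cong_right) (auto dest: permutes_inj simp: inj_permutes)
  finally show ?thesis .
qed

lemma phi_eq_pfaffian:
  fixes e h F
  defines "A \<equiv> components e F" and "B \<equiv> matrix_inv (components e h)"
  assumes e: "frame e" and A: "transpose A = - A" and B: "transpose B = B"
  shows "phi e h F = - 2 * sqrt (- det (components e h)) * pfaffian (B ** A ** B)"
proof -
  define U where "U = B ** A ** B"
  have zero: "(0 :: 4) = 4"
    by simp
  have U: "transpose U = - U"
    by (simp add: U_def matrix_transpose_mul A B matrix_algebra)
  \<comment> \<open>One half comes from the inner product, the other from the Hodge dual; each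
    raises both indices of \<open>F\<close>, and symmetry of \<open>B\<close> makes both results
    \<open>U\<close>.\<close>
  have "phi e h F = 1/4 * sqrt (- det (components e h)) *
      (\<Sum>a\<in>UNIV. \<Sum>b\<in>UNIV. \<Sum>c\<in>UNIV. \<Sum>d\<in>UNIV. levi_civita a b c d * (U$a$b * U$c$d))"
    unfolding phi_def form_inner_eq hodge_frame[OF e] hodge_components_eq
      B_def[symmetric] A_def[symmetric] B U_def[symmetric]
    by (simp add: sum_distrib_left mult_ac)
  also have "(\<Sum>a\<in>UNIV. \<Sum>b\<in>UNIV. \<Sum>c\<in>UNIV. \<Sum>d\<in>UNIV. levi_civita a b c d * (U$a$b * U$c$d)) =
      (\<Sum>p | p permutes UNIV. of_int (sign p) * (U$(p 4)$(p 1) * U$(p 2)$(p 3)))"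
    unfolding sum_levi_civita by (simp add: zero)
  \<comment> \<open>Each of the three matchings in the Pfaffian arises from 8 of the 24
    permutations; the sign is that of the order 4, 1, 2, 3.\<close>
  also have "\<dots> = - 8 * pfaffian U"
    unfolding sum_permutations_4[of "\<lambda>a b c d. U$d$a * U$b$c"]
    by (simp add: pfaffian_def skew_entries_4[OF U] algebra_simps)
  finally show ?thesis by (simp add: U_def)
qed

section \<open>From the matrix identity to tensors\<close>

lemma lorentzian_frame_inverse:
  assumes "lorentzian h" and "frame e"
  defines "G \<equiv> components e h" and "B \<equiv> matrix_inv (components e h)"
  shows "G ** B = mat 1" and "transpose B = B"
proof -
  have "invertible G"
    using lorentzian_det_neg[OF assms(1,2)] by (simp add: G_def invertible_det_nz)
  then have "G ** B = mat 1 \<and> B ** G = mat 1"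
    unfolding B_def G_def[symmetric] invertible_def matrix_inv_def by (rule someI_ex)
  moreover have "transpose G = G"
    using assms(1) by (simp add: G_def components_def lorentzian_def vec_eq_iff
        Finite_Cartesian_Product.transpose_def)
  ultimately show "G ** B = mat 1" and "transpose B = B"
    by (metis, metis matrix_mul_assoc matrix_mul_lid matrix_mul_rid matrix_transpose_mul transpose_mat)
qed

text \<open>The common shape of the disformal metric, the energy-momentum tensor
  (\<open>c = 1\<close>) and a multiple of the metric (\<open>d = 0\<close>).\<close>

lemma bilinear_add_scale:
  fixes h k :: "'v::real_vector tensor"
  assumes "bilinear h" and "bilinear k"
  shows "bilinear (\<lambda>u v. c * (h u v + d * k u v))"
  unfolding bilinear_def linear_iff
  by (simp add: bilinear_ladd[OF assms(1)] bilinear_lmul[OF assms(1)] bilinear_radd[OF assms(1)]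
      bilinear_rmul[OF assms(1)] bilinear_ladd[OF assms(2)] bilinear_lmul[OF assms(2)]
      bilinear_radd[OF assms(2)] bilinear_rmul[OF assms(2)] algebra_simps)

lemma components_add_scale:
  "components e (\<lambda>u v. c * (h u v + d * k u v)) = c *\<^sub>R (components e h + d *\<^sub>R components e k)"
  by (simp add: components_def vec_eq_iff)

theorem mainTheorem2:
  fixes Or :: "'v::real_vector frame set" and e :: "'v frame" and g F :: "'v tensor"
  assumes "dim (UNIV :: 'v set) = 4"
    and "orientation Or"
    and "e \<in> Or"
    and "lorentzian g"
    and "two_form F"
    and "regular e g F"
  shows "energy_momentum e (disformal_metric e g F) F = (\<lambda>u v. - kappa e g F * g u v)"
proof -
  define A where "A = components e F"
  define G where "G = components e g"
  define B where "B = matrix_inv G"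
  define s where "s = psi e g F"
  define k where "k = kappa e g F"
  define g' where "g' = disformal_metric e g F"
  have e: "frame e"
    using assms(2,3) by (auto simp: orientation_def)
  have F: "bilinear F" and g: "bilinear g"
    using assms(4,5) by (auto simp: two_form_def lorentzian_def)
  have A: "transpose A = - A"
  proof -
    have "F u v + F v u = 0" for u v
      using assms(5) unfolding two_form_def by (metis add.left_inverse)
    then show ?thesis
      by (simp add: A_def components_def vec_eq_iff Finite_Cartesian_Product.transpose_def
          eq_neg_iff_add_eq_0)
  qed
  have GB: "G ** B = mat 1" and B: "transpose B = B"
    using lorentzian_frame_inverse[OF assms(4) e] by (simp_all add: G_def B_def)
  have s_eq: "s = - trace (A ** B ** A ** B) / 2"
    unfolding s_def A_def B_def G_def
    by (rule psi_eq_trace[OF A[unfolded A_def] B[unfolded B_def G_def]])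
  have "phi e g F = - 2 * sqrt (- det G) * pfaffian (B ** A ** B)"
    unfolding A_def B_def G_def
    by (rule phi_eq_pfaffian[OF e A[unfolded A_def] B[unfolded B_def G_def]])
  \<comment> \<open>Since \<open>det G\<close> is negative, the square root squares to
    \<open>- det G\<close>.\<close>
  then have "(phi e g F)\<^sup>2 = - 4 * det G * (pfaffian (B ** A ** B))\<^sup>2"
    using lorentzian_det_neg[OF assms(4) e] by (simp add: power_mult_distrib G_def)
  moreover have "k\<^sup>2 = (s\<^sup>2 + (phi e g F)\<^sup>2) / 4"
    by (simp add: k_def kappa_def s_def power_divide)
  ultimately have k: "k\<^sup>2 = s\<^sup>2 / 4 - det G * (pfaffian (B ** A ** B))\<^sup>2"
    by (simp add: field_simps)
  have k0: "k \<noteq> 0"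
    using assms(6) by (simp add: k_def regular_def)
  have g'_fun: "g' = (\<lambda>u v. - inverse k * (tensor_prod e g F F u v + s / 2 * g u v))"
    by (simp add: g'_def disformal_metric_def k_def s_def fun_eq_iff)
  have g': "bilinear g'"
    unfolding g'_fun by (intro bilinear_add_scale bilinear_tensor_prod F g)
  have G': "components e g' = - inverse k *\<^sub>R (A ** B ** A + (s / 2) *\<^sub>R G)"
    unfolding g'_fun components_add_scale components_tensor_prod A_def B_def G_def ..
  note disformal = disformal_matrix[OF A B GB s_eq k k0 G']
  \<comment> \<open>The trace formula for psi applies to \<open>g'\<close> because the inverse of
    its matrix is symmetric, and the trace is unchanged.\<close>
  have s': "psi e g' F = s"
    unfolding s_eq disformal(2)[symmetric] unfolding A_def
    by (rule psi_eq_trace[OF A[unfolded A_def] disformal(1)])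
  \<comment> \<open>The factor 1 fits the shape of \<open>components_add_scale\<close> and
    \<open>bilinear_add_scale\<close>.\<close>
  have T_fun: "energy_momentum e g' F = (\<lambda>u v. 1 * (tensor_prod e g' F F u v + s / 2 * g' u v))"
    by (simp add: energy_momentum_def s' fun_eq_iff)
  have "components e (energy_momentum e g' F) = components e (\<lambda>u v. - k * g u v)"
    using disformal(3) unfolding T_fun components_add_scale components_tensor_prod A_def
    by (simp add: components_def G_def vec_eq_iff)
  moreover have "bilinear (energy_momentum e g' F)"
    unfolding T_fun by (intro bilinear_add_scale bilinear_tensor_prod F g')
  moreover have "bilinear (\<lambda>u v. - k * g u v)"
    using bilinear_add_scale[OF g g, of "- k" 0] by simp
  ultimately show ?thesis
    unfolding g'_def[symmetric] k_def[symmetric] by (intro bilinear_frame_ext[OF e])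
qed

end
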